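(* Let $H\in(\tfrac12,1)$. Let $X$ be the solution of the Vasicek model $dX_t=(\mu_0+\theta_0X_t)\,dt+\sigma\,dS_t^H$, $X_0=x_0$, driven by a sub-fractional Brownian motion $S^H$ of index $H$, where $\theta_0,\mu_0$ are the true values of the parameters $\theta,\mu$. Let $\hat\theta=\hat\theta_{n,\sigma}$ and $\hat\mu=\hat\mu_{n,\sigma}$ be the least squares estimators based on the observations $X_{t_i}$, $t_i=i/n$, $i=0,1,\dots,n$, as defined in the context. Then: (1) $\hat\theta\to\theta_0$ almost surely, as $n\to\infty$ and $\sigma\to0$; (2) $\hat\mu\to\mu_0$ almost surely, as $n\to\infty$ and $\sigma\to0$.
   Context: A sub-fractional Brownian motion $S^H=\{S^H_t,t\ge0\}$ with index $H\in(\tfrac12,1)$ is a mean-zero Gaussian process with continuous paths, $S_0^H=0$ and covariance $$\mathbf E(S_t^HS_s^H)=s^{2H}+t^{2H}-\tfrac12\{|s-t|^{2H}+(s+t)^{2H}\},\quad s,t\ge0.$$ For $\sigma>0$, $x_0\in\mathbb R$ fixed, and true parameter values $\theta_0,\mu_0\in\mathbb R$, the process $X=X^{\sigma}$ is the solution of $$X_t=x_0+\int_0^t(\mu_0+\theta_0X_s)\,ds+\sigma S_t^H,\quad t\in[0,1],$$ with the same $S^H$ used for all $\sigma$ and $n$. The least squares estimators, obtained by minimizing over $(\theta,\mu)$ the contrast $\sum_{i=1}^n|X_{t_i}-X_{t_{i-1}}-(\mu+\theta X_{t_{i-1}})\tfrac1n|^2$ with $t_i=i/n$, are $$\hat\theta=\frac{\sum_{i=1}^{n}(X_{t_i}-X_{t_{i-1}})X_{t_{i-1}}-\frac1n\sum_{i=1}^{n}X_{t_{i-1}}\sum_{i=1}^{n}(X_{t_i}-X_{t_{i-1}})}{\frac1n\sum_{i=1}^{n}X_{t_{i-1}}^2-\frac1{n^2}\left(\sum_{i=1}^{n}X_{t_{i-1}}\right)^2},$$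 $$\hat\mu=\frac{\sum_{i=1}^{n}(X_{t_i}-X_{t_{i-1}})\sum_{i=1}^{n}X_{t_{i-1}}^2-\sum_{i=1}^{n}X_{t_{i-1}}\sum_{i=1}^{n}(X_{t_i}-X_{t_{i-1}})X_{t_{i-1}}}{\sum_{i=1}^{n}X_{t_{i-1}}^2-\frac1n\left(\sum_{i=1}^{n}X_{t_{i-1}}\right)^2}.$$
   Formalization: The case μ₀+θ₀x₀=0 is excluded from (1), and from (2) unless x₀=0, since the claim fails there: then X=x₀+σY, so θ̂ does not depend on σ and tends to a random limit different from θ₀, and μ̂ to minus x₀ times that limit. *)

theory Defs
  imports "HOL-Probability.Probability"
begin

text \<open>The degenerate laws are included, since \<^const>\<open>normal_density\<close> is a density only
  for a positive standard deviation.\<close>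

definition gaussian_rv :: "'a measure \<Rightarrow> ('a \<Rightarrow> real) \<Rightarrow> bool" where
  "gaussian_rv M Y \<longleftrightarrow> Y \<in> borel_measurable M \<and>
     ((\<exists>m. AE \<omega> in M. Y \<omega> = m) \<or>
      (\<exists>m s. 0 < s \<and> distributed M lborel Y (\<lambda>x. ennreal (normal_density m s x))))"

definition gaussian_process :: "'a measure \<Rightarrow> 'i set \<Rightarrow> ('i \<Rightarrow> 'a \<Rightarrow> real) \<Rightarrow> bool" where
  "gaussian_process M T Y \<longleftrightarrow>
     (\<forall>F c. finite F \<and> F \<subseteq> T \<longrightarrow> gaussian_rv M (\<lambda>\<omega>. \<Sum>t\<in>F. c t * Y t \<omega>))"

definition sub_fractional_BM :: "'a measure \<Rightarrow> real \<Rightarrow> (real \<Rightarrow> 'a \<Rightarrow> real) \<Rightarrow> bool" where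
  "sub_fractional_BM M H S \<longleftrightarrow>
     gaussian_process M {0..} S \<and>
     (AE \<omega> in M. continuous_on {0..} (\<lambda>t. S t \<omega>)) \<and>
     (AE \<omega> in M. S 0 \<omega> = 0) \<and>
     (\<forall>t\<ge>0. (\<integral>\<omega>. S t \<omega> \<partial>M) = 0) \<and>
     (\<forall>t\<ge>0. \<forall>s\<ge>0. (\<integral>\<omega>. S t \<omega> * S s \<omega> \<partial>M) =
        s powr (2 * H) + t powr (2 * H) - 1/2 * (\<bar>s - t\<bar> powr (2 * H) + (s + t) powr (2 * H)))"

text \<open>The noise is additive, so the equation is solved path by path: \<open>x\<close> is a path of the
  solution, \<open>w\<close> the corresponding path of the driving process. Continuity of \<open>x\<close> makes the
  integral meaningful.\<close>

definition vasicek_path ::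
    "real \<Rightarrow> real \<Rightarrow> real \<Rightarrow> real \<Rightarrow> (real \<Rightarrow> real) \<Rightarrow> (real \<Rightarrow> real) \<Rightarrow> bool" where
  "vasicek_path \<theta> \<mu> x0 \<sigma> w x \<longleftrightarrow>
     continuous_on {0..1} x \<and>
     (\<forall>t\<in>{0..1}. x t = x0 + integral {0..t} (\<lambda>s. \<mu> + \<theta> * x s) + \<sigma> * w t)"

text \<open>Least squares estimators computed from a path \<open>x\<close> observed at the times \<open>i / n\<close>.\<close>

definition obs :: "nat \<Rightarrow> (real \<Rightarrow> real) \<Rightarrow> nat \<Rightarrow> real" where
  "obs n x i = x (real i / real n)"

definition theta_hat :: "nat \<Rightarrow> (real \<Rightarrow> real) \<Rightarrow> real" where
  "theta_hat n x =
     ((\<Sum>i=1..n. (obs n x i - obs n x (i - 1)) * obs n x (i - 1))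
        - 1 / real n * (\<Sum>i=1..n. obs n x (i - 1)) * (\<Sum>i=1..n. obs n x i - obs n x (i - 1)))
     / (1 / real n * (\<Sum>i=1..n. (obs n x (i - 1))\<^sup>2)
        - 1 / (real n)\<^sup>2 * (\<Sum>i=1..n. obs n x (i - 1))\<^sup>2)"

definition mu_hat :: "nat \<Rightarrow> (real \<Rightarrow> real) \<Rightarrow> real" where
  "mu_hat n x =
     ((\<Sum>i=1..n. obs n x i - obs n x (i - 1)) * (\<Sum>i=1..n. (obs n x (i - 1))\<^sup>2)
        - (\<Sum>i=1..n. obs n x (i - 1)) * (\<Sum>i=1..n. (obs n x i - obs n x (i - 1)) * obs n x (i - 1)))
     / ((\<Sum>i=1..n. (obs n x (i - 1))\<^sup>2)
        - 1 / real n * (\<Sum>i=1..n. obs n x (i - 1))\<^sup>2)"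

end

theory Submission
  imports Defs
begin

text \<open>
  The equation is linear, so for each path \<open>X = x + \<sigma> y\<close> with \<open>x\<close> the solution of the noiseless
  equation and \<open>y\<close> independent of \<open>\<sigma>\<close>. By summation by parts, the sum of \<open>(X\<^sub>i - X\<^sub>i\<^sub>-\<^sub>1) X\<^sub>i\<^sub>-\<^sub>1\<close> is
  half of \<open>X\<^sub>n\<^sup>2 - X\<^sub>0\<^sup>2\<close> minus the quadratic variation along the grid, so both estimators are
  functions of the end points, of Riemann sums of \<open>x\<close> and \<open>y\<close>, and of this quadratic variation. The
  latter vanishes in the limit because \<open>H > 1/2\<close>: the \<open>p\<close>-th moment of the quadratic variation of the
  driving process is of order \<open>n\<close> to the power \<open>p (1 - 2 H)\<close>, which is summable for large \<open>p\<close>.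
  The limits are then identified through \<open>x' = \<mu>0 + \<theta>0 x\<close>, and their denominator is nonzero since
  \<open>x\<close> is not constant if \<open>\<mu>0 + \<theta>0 x0 \<noteq> 0\<close>. If \<open>\<mu>0 = x0 = 0\<close>, then \<open>X = \<sigma> y\<close> and by homogeneity
  the estimator of \<open>\<mu>0\<close> is \<open>\<sigma>\<close> times its value on the fixed path \<open>y\<close>, which is almost surely not constant.
\<close>

subsection \<open>Limits of the estimators along a path\<close>

definition quad_var :: "nat \<Rightarrow> (real \<Rightarrow> real) \<Rightarrow> real" where
  "quad_var n x = (\<Sum>i=1..n. (obs n x i - obs n x (i - 1))\<^sup>2)"

lemma quad_var_nonneg: "0 \<le> quad_var n x"
  by (simp add: quad_var_def sum_nonneg)

lemma obs_time_mem: "i \<le> n \<Longrightarrow> real i / real n \<in> {0..1}"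
  \<comment> \<open>For \<open>n = 0\<close> the quotient is \<open>0\<close>, by the convention on
    division by zero.\<close>
  by (cases "n = 0") (auto simp: divide_simps)

lemma quad_var_cong:
  assumes "\<And>t. t \<in> {0..1} \<Longrightarrow> x t = y t"
  shows "quad_var n x = quad_var n y"
  unfolding quad_var_def obs_def
  by (intro sum.cong refl arg_cong[where f = "\<lambda>a. a\<^sup>2"] arg_cong2[where f = "(-)"] assms obs_time_mem) auto

text \<open>For each increment the gap between the two sides is the square
  \<open>(a - c * b)^2\<close>. The crude factor \<open>2\<close> is harmless, as the bound only
  serves to show that quadratic variations vanish in the limit.\<close>

lemma quad_var_add_le:
  "quad_var n (\<lambda>t. x t + c * y t) \<le> 2 * quad_var n x + 2 * c\<^sup>2 * quad_var n y"
proof -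
  have "(a + c * b)\<^sup>2 \<le> 2 * a\<^sup>2 + 2 * c\<^sup>2 * b\<^sup>2" for a b :: real
    using zero_le_power2[of "a - c * b"] by (simp add: power2_eq_square algebra_simps)
  note le = this
  have "(obs n (\<lambda>t. x t + c * y t) i - obs n (\<lambda>t. x t + c * y t) (i - 1))\<^sup>2
     \<le> 2 * (obs n x i - obs n x (i - 1))\<^sup>2 + 2 * c\<^sup>2 * (obs n y i - obs n y (i - 1))\<^sup>2" for i
    using le[of "obs n x i - obs n x (i - 1)" "obs n y i - obs n y (i - 1)"]
    by (simp add: obs_def algebra_simps)
  then show ?thesis
    unfolding quad_var_def sum_distrib_left sum.distrib[symmetric] by (intro sum_mono)
qed

section \<open>Telescoping sums and summation by parts\<close>

lemma sum_increments:
  fixes g :: "nat \<Rightarrow> real"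
  shows "(\<Sum>i=1..n. g i - g (i - 1)) = g n - g 0"
  by (induction n) auto

text \<open>Since \<open>(a - b) * b = (a^2 - b^2 - (a - b)^2) / 2\<close>, the differences of
  squares telescope and the quadratic variation is split off.\<close>

lemma sum_increments_mult:
  fixes g :: "nat \<Rightarrow> real"
  shows "(\<Sum>i=1..n. (g i - g (i - 1)) * g (i - 1))
    = ((g n)\<^sup>2 - (g 0)\<^sup>2 - (\<Sum>i=1..n. (g i - g (i - 1))\<^sup>2)) / 2"
  by (induction n) (auto simp: power2_eq_square algebra_simps)

section \<open>Riemann sums and primitives\<close>

text \<open>The left side is the modulus of the integral of \<open>f - c\<close> over
  \<open>{a..b}\<close>. The choice \<open>c = f a\<close> gives the error of a Riemann sum on one
  cell, the choice \<open>c = 0\<close> the Lipschitz bound for a primitive.\<close>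

lemma integral_increment_le:
  fixes f :: "real \<Rightarrow> real"
  assumes f: "continuous_on {0..1} f" and "0 \<le> a" "a \<le> b" "b \<le> 1"
    and B: "\<And>t. t \<in> {a..b} \<Longrightarrow> \<bar>f t - c\<bar> \<le> B"
  shows "\<bar>integral {0..b} f - integral {0..a} f - c * (b - a)\<bar> \<le> B * (b - a)"
proof -
  have cont: "continuous_on {u..v} f" if "0 \<le> u" "v \<le> 1" for u v
    using f by (rule continuous_on_subset) (use that in auto)
  have "integral {0..a} f + integral {a..b} f = integral {0..b} f"
    using assms by (intro Henstock_Kurzweil_Integration.integral_combine integrable_continuous_real cont) auto
  moreover have "integral {a..b} (\<lambda>t. f t - c) = integral {a..b} f - c * (b - a)"
    using assms by (subst Henstock_Kurzweil_Integration.integral_diff) (auto intro!: integrable_continuous_real cont)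
  moreover have "norm (integral {a..b} (\<lambda>t. f t - c)) \<le> B * (b - a)"
    using assms by (intro integral_bound continuous_intros cont) auto
  ultimately show ?thesis by (simp add: algebra_simps)
qed

text \<open>By uniform continuity the error on each of the \<open>n\<close> cells is at most
  \<open>e / 2\<close> times the length \<open>1 / n\<close>, so the total error is at most
  \<open>e / 2\<close>.\<close>

lemma riemann_sum_tendsto:
  assumes f: "continuous_on {0..1} f"
  shows "(\<lambda>n. 1 / real n * (\<Sum>i=1..n. f (real (i - 1) / real n))) \<longlonglongrightarrow> integral {0..1} f"
proof (rule metric_LIMSEQ_I)
  fix e :: real assume e: "0 < e"
  have "uniformly_continuous_on {0..1} f"
    using f by (intro compact_uniformly_continuous) auto
  then obtain d where d: "d > 0"
    and uc: "\<And>s t. s \<in> {0..1} \<Longrightarrow> t \<in> {0..1} \<Longrightarrow> \<bar>t - s\<bar> < d \<Longrightarrow> \<bar>f t - f s\<bar> < e / 2"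
    using e unfolding uniformly_continuous_on_def dist_real_def
    by (metis half_gt_zero)
  obtain N :: nat where N: "N > 0" "1 / real N < d"
    using d real_arch_inverse[of d] by (auto simp: inverse_eq_divide)
  show "\<exists>N. \<forall>n\<ge>N. dist (1 / real n * (\<Sum>i=1..n. f (real (i - 1) / real n))) (integral {0..1} f) < e"
  proof (intro exI[of _ N] allI impI)
    fix n assume "n \<ge> N"
    with N have n: "n > 0" "1 / real n < d"
      by (auto intro: order.strict_trans1[OF _ N(2)] simp: frac_le)
    \<comment> \<open>The primitive at the grid points: its increments are the integrals over the
      cells and telescope to the whole integral.\<close>
    define G where "G = (\<lambda>i. integral {0..real i / real n} f)"
    have step: "\<bar>G i - G (i - 1) - f (real (i - 1) / real n) * (1 / real n)\<bar> \<le> e / 2 * (1 / real n)"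
      if i: "i \<in> {1..n}" for i
    proof -
      define a where "a = real (i - 1) / real n"
      have ab: "real i / real n = a + 1 / real n"
        using i by (simp add: a_def of_nat_diff add_divide_distrib[symmetric])
      have a: "a \<in> {0..1}" "a + 1 / real n \<in> {0..1}"
        using i obs_time_mem[of "i - 1" n, folded a_def] obs_time_mem[of i n, unfolded ab] by auto
      have "\<bar>integral {0..a + 1 / real n} f - integral {0..a} f - f a * (a + 1 / real n - a)\<bar>
          \<le> e / 2 * (a + 1 / real n - a)"
      proof (intro integral_increment_le f)
        fix t assume "t \<in> {a..a + 1 / real n}"
        with a n show "\<bar>f t - f a\<bar> \<le> e / 2"
          by (intro less_imp_le uc) auto
      qed (use a in auto)
      then show ?thesis
        unfolding G_def ab a_def[symmetric] by simp
    qed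
    have "integral {0..1} f = (\<Sum>i=1..n. G i - G (i - 1))"
      unfolding sum_increments using n by (simp add: G_def)
    then have "integral {0..1} f - 1 / real n * (\<Sum>i=1..n. f (real (i - 1) / real n))
        = (\<Sum>i=1..n. G i - G (i - 1) - f (real (i - 1) / real n) * (1 / real n))"
      by (simp only: sum_subtractf sum_distrib_left mult.commute)
    also have "\<bar>\<dots>\<bar> \<le> (\<Sum>i=1..n. e / 2 * (1 / real n))"
      by (rule order.trans[OF sum_abs sum_mono]) (rule step)
    also have "\<dots> < e" using n e by simp
    finally show "dist (1 / real n * (\<Sum>i=1..n. f (real (i - 1) / real n))) (integral {0..1} f) < e"
      by (simp add: dist_real_def abs_minus_commute)
  qed
qed

text \<open>A primitive of a continuous function is Lipschitz with some constant \<open>K\<close>,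
  so \<open>n\<close> squared increments of size at most \<open>(K / n)^2\<close> add up to at most
  \<open>K^2 / n\<close>.\<close>

lemma quad_var_integral_tendsto_0:
  assumes g: "continuous_on {0..1} g"
  shows "(\<lambda>n. quad_var n (\<lambda>t. c + integral {0..t} g)) \<longlonglongrightarrow> 0"
proof -
  have "bounded (g ` {0..1})"
    using g by (intro compact_imp_bounded compact_continuous_image) auto
  then obtain K where "\<forall>x\<in>g ` {0..1}. norm x \<le> K"
    unfolding bounded_iff by blast
  then have K: "\<bar>g t\<bar> \<le> K" if "t \<in> {0..1}" for t
    using that by simp
  have le: "quad_var n (\<lambda>t. c + integral {0..t} g) \<le> K\<^sup>2 * (1 / real n)" for n
  proof (cases "n = 0")
    case False
    have "(obs n (\<lambda>t. c + integral {0..t} g) i - obs n (\<lambda>t. c + integral {0..t} g) (i - 1))\<^sup>2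
        \<le> (K * (1 / real n))\<^sup>2" if i: "i \<in> {1..n}" for i
    proof -
      define a where "a = real (i - 1) / real n"
      have ab: "real i / real n = a + 1 / real n"
        using i by (simp add: a_def of_nat_diff add_divide_distrib[symmetric])
      have a: "a \<in> {0..1}" "a + 1 / real n \<in> {0..1}"
        using i obs_time_mem[of "i - 1" n, folded a_def] obs_time_mem[of i n, unfolded ab] by auto
      have "\<bar>integral {0..a + 1 / real n} g - integral {0..a} g - 0 * (a + 1 / real n - a)\<bar>
          \<le> K * (a + 1 / real n - a)"
        using a by (intro integral_increment_le g) (auto intro: K)
      then show ?thesis
        unfolding obs_def ab a_def[symmetric] by (subst power2_le_iff_abs_le) auto
    qed
    then have "quad_var n (\<lambda>t. c + integral {0..t} g) \<le> (\<Sum>i=1..n. (K * (1 / real n))\<^sup>2)"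
      unfolding quad_var_def by (intro sum_mono)
    also have "\<dots> = K\<^sup>2 * (1 / real n)"
      using False by (simp add: power2_eq_square)
    finally show ?thesis .
  qed (simp add: quad_var_def)
  have "(\<lambda>n. K\<^sup>2 * (1 / real n)) \<longlonglongrightarrow> 0"
    by (rule tendsto_mult_right_zero) (rule lim_1_over_n)
  then show ?thesis
    by (rule Lim_null_comparison[rotated]) (use le quad_var_nonneg in auto)
qed

section \<open>Estimators as functions of averages over the grid\<close>

definition grid_mean :: "nat \<Rightarrow> (real \<Rightarrow> real) \<Rightarrow> real" where
  "grid_mean n x = 1 / real n * (\<Sum>i=1..n. obs n x (i - 1))"

lemma theta_hat_eq:
  assumes "0 < n"
  shows "theta_hat n x =
    (((x 1)\<^sup>2 - (x 0)\<^sup>2 - quad_var n x) / 2 - grid_mean n x * (x 1 - x 0))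
    / (grid_mean n (\<lambda>t. (x t)\<^sup>2) - (grid_mean n x)\<^sup>2)"
  unfolding theta_hat_def sum_increments_mult sum_increments quad_var_def grid_mean_def
  using assms by (simp add: obs_def power_mult_distrib power_divide)

text \<open>Numerator and denominator are multiplied by \<open>1 / n\<close>. Every sum becomes an
  average, and the denominator becomes the same empirical variance as in
  \<open>theta_hat_eq\<close>.\<close>

lemma mu_hat_eq:
  assumes "0 < n"
  shows "mu_hat n x =
    ((x 1 - x 0) * grid_mean n (\<lambda>t. (x t)\<^sup>2) - grid_mean n x * (((x 1)\<^sup>2 - (x 0)\<^sup>2 - quad_var n x) / 2))
    / (grid_mean n (\<lambda>t. (x t)\<^sup>2) - (grid_mean n x)\<^sup>2)"
proof -
  have scale: "r * (a * q - s * d) = a * (r * q) - (r * s) * d" "r * (q - r * s\<^sup>2) = r * q - (r * s)\<^sup>2"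
    for a d q r s :: real
    by (simp_all add: algebra_simps power2_eq_square)
  let ?q = "\<Sum>i=1..n. (obs n x (i - 1))\<^sup>2" and ?s = "\<Sum>i=1..n. obs n x (i - 1)"
  let ?D = "(obs n x n)\<^sup>2 - (obs n x 0)\<^sup>2 - quad_var n x"
  have "mu_hat n x = ((obs n x n - obs n x 0) * ?q - ?s * (?D / 2)) / (?q - 1 / real n * ?s\<^sup>2)"
    unfolding mu_hat_def sum_increments_mult sum_increments quad_var_def ..
  also have "\<dots> = (1 / real n * ((obs n x n - obs n x 0) * ?q - ?s * (?D / 2)))
      / (1 / real n * (?q - 1 / real n * ?s\<^sup>2))"
    using assms by (subst mult_divide_mult_cancel_left) auto
  also have "\<dots> = ((obs n x n - obs n x 0) * (1 / real n * ?q) - (1 / real n * ?s) * (?D / 2))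
    / (1 / real n * ?q - (1 / real n * ?s)\<^sup>2)"
    unfolding scale ..
  finally show ?thesis
    using assms by (simp add: obs_def grid_mean_def)
qed

lemma grid_mean_tendsto:
  assumes "continuous_on {0..1} x"
  shows "(\<lambda>n. grid_mean n x) \<longlonglongrightarrow> integral {0..1} x"
  unfolding grid_mean_def obs_def by (rule riemann_sum_tendsto[OF assms])

lemma grid_mean_add: "grid_mean n (\<lambda>t. x t + y t) = grid_mean n x + grid_mean n y"
  by (simp add: grid_mean_def obs_def sum.distrib distrib_left)

lemma grid_mean_cmult: "grid_mean n (\<lambda>t. c * x t) = c * grid_mean n x"
  by (simp add: grid_mean_def obs_def sum_distrib_left ac_simps)

lemma quad_var_cmult: "quad_var n (\<lambda>t. c * x t) = c\<^sup>2 * quad_var n x"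
  unfolding quad_var_def obs_def right_diff_distrib[symmetric] power_mult_distrib sum_distrib_left ..

text \<open>In the path, the numerator is homogeneous of degree three and the denominator of degree
  two.\<close>

lemma mu_hat_cmult: "mu_hat n (\<lambda>t. c * x t) = c * mu_hat n x"
proof (cases "n = 0 \<or> c = 0")
  case True
  then show ?thesis by (auto simp: mu_hat_def obs_def)
next
  case False
  let ?m = "grid_mean n x" and ?q = "grid_mean n (\<lambda>t. (x t)\<^sup>2)"
  have scale: "(c * a - c * b) * (c\<^sup>2 * q) - c * m * (((c * a)\<^sup>2 - (c * b)\<^sup>2 - c\<^sup>2 * v) / 2)
      = c\<^sup>2 * (c * ((a - b) * q - m * ((a\<^sup>2 - b\<^sup>2 - v) / 2)))"
    "c\<^sup>2 * q - (c * m)\<^sup>2 = c\<^sup>2 * (q - m\<^sup>2)" for a b q m v :: real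
    by (simp_all add: algebra_simps power2_eq_square diff_divide_distrib add_divide_distrib)
  from False have "mu_hat n (\<lambda>t. c * x t) =
    (c ^ 2 * (c * ((x 1 - x 0) * ?q - ?m * (((x 1)\<^sup>2 - (x 0)\<^sup>2 - quad_var n x) / 2))))
    / (c ^ 2 * (?q - ?m\<^sup>2))"
    unfolding scale[symmetric] using grid_mean_cmult[of n "c\<^sup>2" "\<lambda>t. (x t)\<^sup>2"]
    by (simp add: mu_hat_eq grid_mean_cmult quad_var_cmult power_mult_distrib[of c "x _"])
  also have "\<dots> = c * mu_hat n x"
    using False by (simp add: mu_hat_eq)
  finally show ?thesis .
qed

text \<open>The averages of the perturbed path converge to the integrals for \<open>x\<close>,
  because every term that contains \<open>y\<close> carries a factor \<open>c p\<close> tending to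
  zero; the quadratic variation disappears. The general filter \<open>F\<close> covers both the
  joint limit in \<open>n\<close> and \<open>\<sigma>\<close> and the limit in \<open>n\<close>
  alone along a fixed path.\<close>

lemma estimators_tendsto:
  fixes x y :: "real \<Rightarrow> real"
  assumes x: "continuous_on {0..1} x" and y: "continuous_on {0..1} y"
    and qx: "(\<lambda>n. quad_var n x) \<longlonglongrightarrow> 0" and qy: "(\<lambda>n. quad_var n y) \<longlonglongrightarrow> 0"
    and N: "filterlim N sequentially F" and c: "(c \<longlongrightarrow> 0) F"
    and V: "integral {0..1} (\<lambda>t. (x t)\<^sup>2) - (integral {0..1} x)\<^sup>2 \<noteq> 0"
  defines "m \<equiv> integral {0..1} x" and "q \<equiv> integral {0..1} (\<lambda>t. (x t)\<^sup>2)"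
    and "d \<equiv> ((x 1)\<^sup>2 - (x 0)\<^sup>2) / 2"
  shows theta_hat_tendsto: "((\<lambda>p. theta_hat (N p) (\<lambda>t. x t + c p * y t)) \<longlongrightarrow>
      (d - m * (x 1 - x 0)) / (q - m\<^sup>2)) F"
    and mu_hat_tendsto: "((\<lambda>p. mu_hat (N p) (\<lambda>t. x t + c p * y t)) \<longlongrightarrow>
      ((x 1 - x 0) * q - m * d) / (q - m\<^sup>2)) F"
proof -
  let ?z = "\<lambda>p t. x t + c p * y t"
  note gm = filterlim_compose[OF grid_mean_tendsto N]
  note c2 = tendsto_power[OF c, of 2]
  have Npos: "eventually (\<lambda>p. 0 < N p) F"
    using filterlim_compose[OF filterlim_real_sequentially N, unfolded filterlim_at_top_dense, rule_format, of 0]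
    by simp
  have m: "((\<lambda>p. grid_mean (N p) (?z p)) \<longlongrightarrow> m) F"
    unfolding grid_mean_add grid_mean_cmult m_def
    using tendsto_add[OF gm[OF x] tendsto_mult[OF c gm[OF y]]] by simp
  \<comment> \<open>The square is expanded so that the averages are those of functions independent
    of \<open>p\<close>, to which the convergence of Riemann sums applies.\<close>
  have "(\<lambda>t. (?z p t)\<^sup>2) = (\<lambda>t. (x t)\<^sup>2 + (2 * c p * (x t * y t) + (c p)\<^sup>2 * (y t)\<^sup>2))" for p
    by (auto simp: power2_eq_square algebra_simps)
  then have q: "((\<lambda>p. grid_mean (N p) (\<lambda>t. (?z p t)\<^sup>2)) \<longlongrightarrow> q) F"
    unfolding q_def
    using tendsto_add[OF gm[of "\<lambda>t. (x t)\<^sup>2"] tendsto_add[OF tendsto_mult[OF tendsto_mult[OF tendsto_const[of 2] c]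
      gm[of "\<lambda>t. x t * y t"]] tendsto_mult[OF c2 gm[of "\<lambda>t. (y t)\<^sup>2"]]]] x y
    by (simp add: grid_mean_add grid_mean_cmult continuous_intros)
  have "((\<lambda>p. 2 * quad_var (N p) x + 2 * (c p)\<^sup>2 * quad_var (N p) y) \<longlongrightarrow> 2 * 0 + 2 * 0\<^sup>2 * 0) F"
    by (intro tendsto_intros c filterlim_compose[OF qx N] filterlim_compose[OF qy N])
  then have "((\<lambda>p. 2 * quad_var (N p) x + 2 * (c p)\<^sup>2 * quad_var (N p) y) \<longlongrightarrow> 0) F"
    by (simp only: mult_zero_right add_0_left)
  then have qv: "((\<lambda>p. quad_var (N p) (?z p)) \<longlongrightarrow> 0) F"
    by (rule Lim_null_comparison[rotated, where g = "\<lambda>p. 2 * quad_var (N p) x + 2 * (c p)\<^sup>2 * quad_var (N p) y"])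
       (auto simp: quad_var_add_le quad_var_nonneg)
  have z: "((\<lambda>p. ?z p t) \<longlongrightarrow> x t) F" for t
    using tendsto_add[OF tendsto_const[of "x t"] tendsto_mult[OF c tendsto_const[of "y t"]]] by simp
  have d: "((\<lambda>p. ((?z p 1)\<^sup>2 - (?z p 0)\<^sup>2 - quad_var (N p) (?z p)) / 2) \<longlongrightarrow> d) F"
    unfolding d_def by (rule tendsto_eq_intros z qv refl | simp)+
  have V: "q - m\<^sup>2 \<noteq> 0" using V by (simp add: q_def m_def)
  show "((\<lambda>p. theta_hat (N p) (?z p)) \<longlongrightarrow> (d - m * (x 1 - x 0)) / (q - m\<^sup>2)) F"
  proof (rule Lim_transform_eventually)
    show "eventually (\<lambda>p. (((?z p 1)\<^sup>2 - (?z p 0)\<^sup>2 - quad_var (N p) (?z p)) / 2 - grid_mean (N p) (?z p) * (?z p 1 - ?z p 0))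
      / (grid_mean (N p) (\<lambda>t. (?z p t)\<^sup>2) - (grid_mean (N p) (?z p))\<^sup>2) = theta_hat (N p) (?z p)) F"
      using Npos by eventually_elim (simp add: theta_hat_eq)
  qed (intro tendsto_intros d m q z V)
  show "((\<lambda>p. mu_hat (N p) (?z p)) \<longlongrightarrow> ((x 1 - x 0) * q - m * d) / (q - m\<^sup>2)) F"
  proof (rule Lim_transform_eventually)
    show "eventually (\<lambda>p. ((?z p 1 - ?z p 0) * grid_mean (N p) (\<lambda>t. (?z p t)\<^sup>2)
        - grid_mean (N p) (?z p) * (((?z p 1)\<^sup>2 - (?z p 0)\<^sup>2 - quad_var (N p) (?z p)) / 2))
      / (grid_mean (N p) (\<lambda>t. (?z p t)\<^sup>2) - (grid_mean (N p) (?z p))\<^sup>2) = mu_hat (N p) (?z p)) F"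
      using Npos by eventually_elim (simp add: mu_hat_eq)
  qed (intro tendsto_intros d m q z V)
qed

text \<open>As the interval has length one, the difference is the integral of
  \<open>(x t - m)^2\<close> with \<open>m\<close> the mean of \<open>x\<close>. If it were zero,
  continuity would force \<open>x\<close> to be constant.\<close>

lemma variance_pos:
  fixes x :: "real \<Rightarrow> real"
  assumes x: "continuous_on {0..1} x" and ne: "t \<in> {0..1}" "x t \<noteq> x 0"
  shows "integral {0..1} (\<lambda>t. (x t)\<^sup>2) - (integral {0..1} x)\<^sup>2 \<noteq> 0"
proof
  let ?m = "integral {0..1} x"
  assume 0: "integral {0..1} (\<lambda>t. (x t)\<^sup>2) - ?m\<^sup>2 = 0"
  have int: "x integrable_on {0..1}" "(\<lambda>t. (x t)\<^sup>2) integrable_on {0..1}"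
    by (intro integrable_continuous_real continuous_intros x)+
  have "((\<lambda>t. (x t)\<^sup>2 - 2 * ?m * x t + ?m\<^sup>2) has_integral
      integral {0..1} (\<lambda>t. (x t)\<^sup>2) - 2 * ?m * ?m + (1 - 0) *\<^sub>R ?m\<^sup>2) {0..1}"
    using int by (intro has_integral_add has_integral_diff has_integral_mult_right integrable_integral)
       (auto intro!: has_integral_const_real[of _ 0 1, simplified])
  then have "integral {0..1} (\<lambda>t. (x t - ?m)\<^sup>2) = 0"
    using 0 by (intro integral_unique) (simp add: power2_eq_square algebra_simps)
  moreover have "continuous_on {0..1} (\<lambda>t. (x t - ?m)\<^sup>2)"
    by (intro continuous_intros x)
  ultimately have "\<forall>t\<in>{0..1}. (x t - ?m)\<^sup>2 = 0"
    by (subst (asm) integral_eq_0_iff) auto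
  with ne show False by (metis atLeastAtMost_iff eq_iff_diff_eq_0 order.refl zero_eq_power2 zero_le_one)
qed

section \<open>The linear integral equation\<close>

text \<open>The primitive \<open>I\<close> of \<open>z\<close> satisfies
  \<open>I' = \<theta> * I\<close> and \<open>I 0 = 0\<close>. With the integrating factor
  \<open>exp (- \<theta> * t)\<close> it becomes a constant, which is zero.\<close>

lemma linear_integral_eq_unique:
  fixes z :: "real \<Rightarrow> real"
  assumes z: "continuous_on {0..1} z" and eq: "\<And>t. t \<in> {0..1} \<Longrightarrow> z t = \<theta> * integral {0..t} z"
    and t: "t \<in> {0..1}"
  shows "z t = 0"
proof -
  define I where "I = (\<lambda>t. integral {0..t} z)"
  have "((\<lambda>t. exp (- \<theta> * t) * I t) has_real_derivative 0) (at t within {0..1})" if "t \<in> {0..1}" for t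
    unfolding I_def using that
    by (auto intro!: derivative_eq_intros integral_has_real_derivative z simp: eq[OF that])
  then obtain k where k: "\<And>t. t \<in> {0..1} \<Longrightarrow> exp (- \<theta> * t) * I t = k"
    using has_field_derivative_zero_constant[of "{0..1}" "\<lambda>t. exp (- \<theta> * t) * I t"] by auto
  from k[of 0] have "k = 0" by (simp add: I_def)
  with k[OF t] show ?thesis by (simp add: eq[OF t] I_def)
qed

text \<open>Superposition for fixed \<open>\<theta>\<close> and \<open>w\<close>. It reduces
  uniqueness to the equation with zero data, and it builds the noiseless solution and the response
  to the noise out of given solutions.\<close>

lemma vasicek_path_lincomb:
  assumes x: "vasicek_path \<theta> \<mu> x0 \<sigma> w x" and y: "vasicek_path \<theta> \<mu>' y0 \<sigma>' w y"
  shows "vasicek_path \<theta> (a * \<mu> + b * \<mu>') (a * x0 + b * y0) (a * \<sigma> + b * \<sigma>') w (\<lambda>t. a * x t + b * y t)"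
  unfolding vasicek_path_def
proof (intro conjI ballI)
  have cx: "continuous_on {0..1} x" and cy: "continuous_on {0..1} y"
    using x y by (auto simp: vasicek_path_def)
  then show "continuous_on {0..1} (\<lambda>t. a * x t + b * y t)"
    by (intro continuous_intros)
  fix t :: real assume t: "t \<in> {0..1}"
  have cont: "continuous_on {0..t} x" "continuous_on {0..t} y"
    by (rule continuous_on_subset[OF cx] continuous_on_subset[OF cy], use t in auto)+
  have "integral {0..t} (\<lambda>s. (a * \<mu> + b * \<mu>') + \<theta> * (a * x s + b * y s))
      = integral {0..t} (\<lambda>s. a * (\<mu> + \<theta> * x s) + b * (\<mu>' + \<theta> * y s))"
    by (simp add: algebra_simps)
  also have "\<dots> = a * integral {0..t} (\<lambda>s. \<mu> + \<theta> * x s) + b * integral {0..t} (\<lambda>s. \<mu>' + \<theta> * y s)"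
    by (subst Henstock_Kurzweil_Integration.integral_add)
       (auto intro!: integrable_continuous_real continuous_intros cont)
  finally show "a * x t + b * y t = a * x0 + b * y0
      + integral {0..t} (\<lambda>s. (a * \<mu> + b * \<mu>') + \<theta> * (a * x s + b * y s)) + (a * \<sigma> + b * \<sigma>') * w t"
    using x y t by (simp add: vasicek_path_def algebra_simps)
qed

lemma vasicek_path_unique:
  assumes x: "vasicek_path \<theta> \<mu> x0 \<sigma> w x" and y: "vasicek_path \<theta> \<mu> x0 \<sigma> w y" and t: "t \<in> {0..1}"
  shows "x t = y t"
proof -
  have "vasicek_path \<theta> 0 0 0 w (\<lambda>t. x t - y t)"
    using vasicek_path_lincomb[OF x y, of 1 "-1"] by simp
  then have "x t - y t = 0"
    by (intro linear_integral_eq_unique[of _ \<theta>] t) (auto simp: vasicek_path_def)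
  then show ?thesis by simp
qed

text \<open>The path is a primitive of a continuous function plus a multiple of \<open>w\<close>,
  and the first summand has vanishing quadratic variation.\<close>

lemma quad_var_vasicek_path:
  assumes x: "vasicek_path \<theta> \<mu> x0 \<sigma> w x" and w: "\<sigma> \<noteq> 0 \<longrightarrow> (\<lambda>n. quad_var n w) \<longlonglongrightarrow> 0"
  shows "(\<lambda>n. quad_var n x) \<longlonglongrightarrow> 0"
proof -
  have cx: "continuous_on {0..1} x"
    using x by (auto simp: vasicek_path_def)
  let ?g = "\<lambda>t. x0 + integral {0..t} (\<lambda>s. \<mu> + \<theta> * x s)"
  have g: "(\<lambda>n. quad_var n ?g) \<longlonglongrightarrow> 0"
    by (intro quad_var_integral_tendsto_0 continuous_intros cx)
  have eq: "quad_var n x = quad_var n (\<lambda>t. ?g t + \<sigma> * w t)" for n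
    using x by (intro quad_var_cong) (auto simp: vasicek_path_def)
  have le: "quad_var n x \<le> 2 * quad_var n ?g + 2 * (\<sigma>\<^sup>2 * quad_var n w)" for n
    unfolding eq using quad_var_add_le[of n ?g \<sigma> w] by (simp only: mult.assoc)
  have w': "(\<lambda>n. \<sigma>\<^sup>2 * quad_var n w) \<longlonglongrightarrow> 0"
    using w by (cases "\<sigma> = 0") (auto intro: tendsto_mult_right_zero)
  have "(\<lambda>n. 2 * quad_var n ?g + 2 * (\<sigma>\<^sup>2 * quad_var n w)) \<longlonglongrightarrow> 2 * 0 + 2 * 0"
    by (intro tendsto_intros g w')
  then have "(\<lambda>n. 2 * quad_var n ?g + 2 * (\<sigma>\<^sup>2 * quad_var n w)) \<longlonglongrightarrow> 0"
    by (simp only: mult_zero_right add_0_left)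
  then show ?thesis
    by (rule Lim_null_comparison[rotated, where g = "\<lambda>n. 2 * quad_var n ?g + 2 * (\<sigma>\<^sup>2 * quad_var n w)"])
       (simp_all add: quad_var_nonneg le)
qed

text \<open>Integration of \<open>x' = \<mu> + \<theta> * x\<close> and of the same equation
  multiplied by \<open>x\<close>. These are the normal equations of least squares in the limit:
  linear in \<open>\<mu>\<close> and \<open>\<theta>\<close>, with determinant
  \<open>q - m^2\<close> up to sign.\<close>

lemma vasicek_path_moments:
  assumes x: "vasicek_path \<theta> \<mu> x0 0 w x"
  defines "m \<equiv> integral {0..1} x" and "q \<equiv> integral {0..1} (\<lambda>t. (x t)\<^sup>2)"
  shows "x 1 - x 0 = \<mu> + \<theta> * m" and "((x 1)\<^sup>2 - (x 0)\<^sup>2) / 2 = \<mu> * m + \<theta> * q"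
proof -
  have cx: "continuous_on {0..1} x"
    using x by (auto simp: vasicek_path_def)
  have int: "x integrable_on {0..1}" "(\<lambda>t. (x t)\<^sup>2) integrable_on {0..1}"
    by (intro integrable_continuous_real continuous_intros cx)+
  have der: "(x has_real_derivative \<mu> + \<theta> * x t) (at t within {0..1})" if t: "t \<in> {0..1}" for t
  proof (rule has_field_derivative_transform_within[OF _ zero_less_one t])
    show "((\<lambda>t. x0 + integral {0..t} (\<lambda>s. \<mu> + \<theta> * x s)) has_real_derivative \<mu> + \<theta> * x t) (at t within {0..1})"
      by (auto intro!: derivative_eq_intros integral_has_real_derivative continuous_intros cx t)
  qed (use x in \<open>auto simp: vasicek_path_def\<close>)
  have "((\<lambda>t. \<mu> + \<theta> * x t) has_integral (x 1 - x 0)) {0..1}"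
    by (rule fundamental_theorem_of_calculus)
       (auto simp: has_real_derivative_iff_has_vector_derivative[symmetric] intro: der)
  moreover have "((\<lambda>t. \<mu> + \<theta> * x t) has_integral ((1 - 0) *\<^sub>R \<mu> + \<theta> * m)) {0..1}"
    unfolding m_def using int has_integral_const_real[of \<mu> 0 1]
    by (intro has_integral_add has_integral_mult_right integrable_integral) auto
  ultimately show "x 1 - x 0 = \<mu> + \<theta> * m"
    by (auto dest: has_integral_unique)
  have "((\<lambda>t. (\<mu> + \<theta> * x t) * x t) has_integral ((x 1)\<^sup>2 / 2 - (x 0)\<^sup>2 / 2)) {0..1}"
    by (rule fundamental_theorem_of_calculus)
       (auto simp: has_real_derivative_iff_has_vector_derivative[symmetric] intro!: derivative_eq_intros der)
  moreover have "((\<lambda>t. \<mu> * x t + \<theta> * (x t)\<^sup>2) has_integral (\<mu> * m + \<theta> * q)) {0..1}"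
    unfolding m_def q_def using int
    by (intro has_integral_add has_integral_mult_right integrable_integral) auto
  moreover have "(\<lambda>t. (\<mu> + \<theta> * x t) * x t) = (\<lambda>t. \<mu> * x t + \<theta> * (x t)\<^sup>2)"
    by (auto simp: power2_eq_square algebra_simps)
  ultimately show "((x 1)\<^sup>2 - (x 0)\<^sup>2) / 2 = \<mu> * m + \<theta> * q"
    by (auto dest: has_integral_unique simp: diff_divide_distrib)
qed

subsection \<open>Quadratic variation of sub-fractional Brownian motion\<close>

text \<open>Convexity of the power function at the midpoint, multiplied by
  \<open>2 powr r\<close>.\<close>

lemma powr_midpoint_convex:
  fixes s t r :: real
  assumes "1 \<le> r" "0 \<le> s" "0 \<le> t"
  shows "(s + t) powr r \<le> 2 powr (r - 1) * (s powr r + t powr r)"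
proof (cases "s = 0 \<or> t = 0")
  case True
  \<comment> \<open>With one argument zero, the claim comes down to
    \<open>1 \<le> 2 powr (r - 1)\<close>.\<close>
  have "1 * u powr r \<le> 2 powr (r - 1) * u powr r" for u :: real
    using assms by (intro mult_right_mono ge_one_powr_ge_zero) auto
  with True assms show ?thesis by auto
next
  case False
  with assms have pos: "0 < s" "0 < t" by auto
  have "((1 - 1/2) *\<^sub>R s + (1/2) *\<^sub>R t) powr r \<le> (1 - 1/2) * s powr r + (1/2) * t powr r"
    using powr_convex[OF assms(1)] pos by (intro convex_onD) auto
  then have "((s + t) / 2) powr r \<le> (s powr r + t powr r) / 2"
    by (simp add: field_simps)
  then have "2 powr r * ((s + t) / 2) powr r \<le> 2 powr r * ((s powr r + t powr r) / 2)"
    by (intro mult_left_mono) auto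
  moreover have "2 powr r * ((s + t) / 2) powr r = (2 * ((s + t) / 2)) powr r"
    by (rule powr_mult[symmetric]; use pos in simp)
  then have "2 powr r * ((s + t) / 2) powr r = (s + t) powr r"
    by (simp only: nonzero_mult_div_cancel_left times_divide_eq_right)
  ultimately show ?thesis by (simp add: powr_diff)
qed

text \<open>Jensen's inequality for an even power with equal weights. For the quadratic variation it
  reduces everything to moments of single increments, whatever their dependence.\<close>

lemma sum_power_le_even:
  fixes f :: "'i \<Rightarrow> real"
  assumes "finite A" "even p" "0 < p"
  shows "(\<Sum>i\<in>A. f i) ^ p \<le> real (card A) ^ (p - 1) * (\<Sum>i\<in>A. f i ^ p)"
proof (cases "A = {}")
  case False
  let ?n = "real (card A)"
  have n: "?n > 0" using False assms by (simp add: card_gt_0_iff)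
  have "(\<Sum>i\<in>A. (1 / ?n) *\<^sub>R f i) ^ p \<le> (\<Sum>i\<in>A. (1 / ?n) * f i ^ p)"
    using n False assms by (intro convex_on_sum[OF _ _ convex_power_even]) auto
  then have "((\<Sum>i\<in>A. f i) / ?n) ^ p \<le> (\<Sum>i\<in>A. f i ^ p) / ?n"
    by (simp add: sum_divide_distrib)
  then have "?n ^ p * ((\<Sum>i\<in>A. f i) / ?n) ^ p \<le> ?n ^ p * ((\<Sum>i\<in>A. f i ^ p) / ?n)"
    by (intro mult_left_mono) auto
  moreover have "?n ^ p = ?n ^ (p - 1) * ?n"
    using \<open>0 < p\<close> by (simp add: power_eq_if)
  ultimately show ?thesis
    using n by (simp add: power_divide)
qed (use assms in \<open>simp add: zero_power\<close>)

text \<open>The series of the \<open>f n\<close> has finite integral, hence converges almost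
  everywhere, and the terms of a convergent series tend to zero.\<close>

lemma AE_tendsto_0_if_summable_integral:
  fixes f :: "nat \<Rightarrow> 'a \<Rightarrow> real"
  assumes f: "\<And>n. integrable M (f n)" "\<And>n \<omega>. 0 \<le> f n \<omega>"
    and sum: "summable (\<lambda>n. \<integral>\<omega>. f n \<omega> \<partial>M)"
  shows "AE \<omega> in M. (\<lambda>n. f n \<omega>) \<longlonglongrightarrow> 0"
proof -
  have [measurable]: "f n \<in> borel_measurable M" for n
    using f(1) by auto
  have "(\<integral>\<^sup>+\<omega>. (\<Sum>n. ennreal (f n \<omega>)) \<partial>M) = (\<Sum>n. \<integral>\<^sup>+\<omega>. ennreal (f n \<omega>) \<partial>M)"
    by (rule nn_integral_suminf) simp
  also have "\<dots> = (\<Sum>n. ennreal (\<integral>\<omega>. f n \<omega> \<partial>M))"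
    using f by (simp add: nn_integral_eq_integral)
  also have "\<dots> = ennreal (\<Sum>n. \<integral>\<omega>. f n \<omega> \<partial>M)"
    using sum f by (intro suminf_ennreal2) auto
  finally have "(\<integral>\<^sup>+\<omega>. (\<Sum>n. ennreal (f n \<omega>)) \<partial>M) \<noteq> \<infinity>" by simp
  then have "AE \<omega> in M. (\<Sum>n. ennreal (f n \<omega>)) \<noteq> \<infinity>"
    by (intro nn_integral_noteq_infinite) auto
  then show ?thesis
  proof eventually_elim
    case (elim \<omega>)
    with f show ?case
      by (intro summable_LIMSEQ_zero summable_suminf_not_top) auto
  qed
qed

lemma estimators_cong:
  assumes "\<And>t. t \<in> {0..1} \<Longrightarrow> x t = y t"
  shows theta_hat_cong: "theta_hat n x = theta_hat n y" and mu_hat_cong: "mu_hat n x = mu_hat n y"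
proof -
  have eq: "obs n x i = obs n y i" "obs n x (i - 1) = obs n y (i - 1)" if "i \<in> {1..n}" for i
    unfolding obs_def using that by (intro assms obs_time_mem; auto)+
  show "theta_hat n x = theta_hat n y" "mu_hat n x = mu_hat n y"
    unfolding theta_hat_def mu_hat_def by (simp_all add: eq cong: sum.cong_simp del: One_nat_def)
qed

section \<open>Centered Gaussian variables\<close>

context prob_space
begin

text \<open>In both cases of \<open>gaussian_rv\<close> the parameter \<open>m\<close> is the
  mean.\<close>

lemma centered_gaussian_cases:
  assumes "gaussian_rv M Y" "expectation Y = 0"
  obtains "AE \<omega> in M. Y \<omega> = 0"
  | s where "0 < s" "distributed M lborel Y (\<lambda>x. ennreal (normal_density 0 s x))"
proof -
  from assms(1) have [measurable]: "Y \<in> borel_measurable M"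
    by (auto simp: gaussian_rv_def)
  from assms(1) consider m where "AE \<omega> in M. Y \<omega> = m"
    | m s where "0 < s" "distributed M lborel Y (\<lambda>x. ennreal (normal_density m s x))"
    by (auto simp: gaussian_rv_def)
  then show thesis
  proof cases
    case 1
    then have "expectation Y = expectation (\<lambda>_. m)"
      by (intro integral_cong_AE) auto
    with assms 1 show thesis by (intro that(1)) (simp add: prob_space)
  next
    case 2
    have "expectation Y = m"
      using distributed_integral[OF 2(2), of "\<lambda>x. x"] integral_normal_moment_nz_1[OF 2(1), of m] by simp
    with assms 2 show thesis by (intro that(2)) auto
  qed
qed

text \<open>The even moments are expressed through the variance, so that one formula covers the
  degenerate law as well as the normal densities.\<close>

lemma centered_gaussian_moments:
  assumes Y: "gaussian_rv M Y" "expectation Y = 0"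
  shows integrable_centered_gaussian_power: "integrable M (\<lambda>\<omega>. Y \<omega> ^ k)"
    and centered_gaussian_even_moment:
      "expectation (\<lambda>\<omega>. Y \<omega> ^ (2 * k)) = fact (2 * k) / (2 ^ k * fact k) * expectation (\<lambda>\<omega>. (Y \<omega>)\<^sup>2) ^ k"
proof -
  from Y(1) have [measurable]: "Y \<in> borel_measurable M"
    by (auto simp: gaussian_rv_def)
  have *: "integrable M (\<lambda>\<omega>. Y \<omega> ^ k) \<and>
      expectation (\<lambda>\<omega>. Y \<omega> ^ (2 * k)) = fact (2 * k) / (2 ^ k * fact k) * expectation (\<lambda>\<omega>. (Y \<omega>)\<^sup>2) ^ k"
    using Y
  proof (cases rule: centered_gaussian_cases)
    case 1
    then have eq: "AE \<omega> in M. Y \<omega> ^ j = 0 ^ j" for j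
      by eventually_elim simp
    have "integrable M (\<lambda>\<omega>. Y \<omega> ^ k) \<longleftrightarrow> integrable M (\<lambda>\<omega>. 0 ^ k :: real)"
      by (intro integrable_cong_AE eq) auto
    moreover have "expectation (\<lambda>\<omega>. Y \<omega> ^ j) = expectation (\<lambda>\<omega>. 0 ^ j)" for j
      by (intro integral_cong_AE eq) auto
    ultimately show ?thesis
      \<comment> \<open>The case \<open>k = 0\<close> is separate because
        \<open>0 ^ 0 = 1\<close>.\<close>
      by (cases "k = 0") (auto simp: prob_space zero_power)
  next
    case (2 s)
    have "integrable lborel (\<lambda>x. normal_density 0 s x * x ^ k)"
      using integrable_normal_moment[OF 2(1), of 0 k] by simp
    then have "integrable M (\<lambda>\<omega>. Y \<omega> ^ k)"
      using distributed_integrable[OF 2(2), of "\<lambda>x. x ^ k"] by simp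
    moreover have mom: "expectation (\<lambda>\<omega>. Y \<omega> ^ (2 * j)) = fact (2 * j) / ((2 / s\<^sup>2) ^ j * fact j)" for j
      using distributed_integral[OF 2(2), of "\<lambda>x. x ^ (2 * j)"]
        integral_normal_moment_even[OF 2(1), of 0 j] by simp
    moreover have "expectation (\<lambda>\<omega>. (Y \<omega>)\<^sup>2) = s\<^sup>2"
      using mom[of 1] by (simp add: fact_numeral)
    ultimately show ?thesis
      by (simp add: power_divide)
  qed
  then show "integrable M (\<lambda>\<omega>. Y \<omega> ^ k)"
    and "expectation (\<lambda>\<omega>. Y \<omega> ^ (2 * k)) = fact (2 * k) / (2 ^ k * fact k) * expectation (\<lambda>\<omega>. (Y \<omega>)\<^sup>2) ^ k"
    by auto
qed

text \<open>Nonzero variance excludes the degenerate law, and a law with a density has no atom at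
  zero.\<close>

lemma centered_gaussian_AE_nonzero:
  assumes Y: "gaussian_rv M Y" "expectation Y = 0" and var: "expectation (\<lambda>\<omega>. (Y \<omega>)\<^sup>2) \<noteq> 0"
  shows "AE \<omega> in M. Y \<omega> \<noteq> 0"
  using Y
proof (cases rule: centered_gaussian_cases)
  case 1
  have "Y \<in> borel_measurable M" using Y(1) by (auto simp: gaussian_rv_def)
  then have "expectation (\<lambda>\<omega>. (Y \<omega>)\<^sup>2) = expectation (\<lambda>\<omega>. 0)"
    using 1 by (intro integral_cong_AE) auto
  with var show ?thesis by simp
next
  case (2 s)
  show ?thesis
    by (subst distributed_AE2[OF 2(2)]) (auto intro: eventually_mono[OF AE_lborel_singleton[of 0]])
qed

section \<open>Increments and quadratic variation of the driving process\<close>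

text \<open>The variance is \<open>(t - s) powr (2 * H)\<close> minus the convexity defect of the
  power \<open>2 * H\<close> at the midpoint of \<open>s\<close> and \<open>t\<close>, which is
  nonnegative.\<close>

lemma sub_fractional_BM_increment:
  assumes S: "sub_fractional_BM M H S" and H: "1/2 < H" and st: "0 \<le> s" "s < t"
  defines "D \<equiv> \<lambda>\<omega>. S t \<omega> - S s \<omega>"
  shows "gaussian_rv M D" and "expectation D = 0"
    and "expectation (\<lambda>\<omega>. (D \<omega>)\<^sup>2) \<le> (t - s) powr (2 * H)"
proof -
  have G: "gaussian_process M {0..} S" and mean: "\<And>t. 0 \<le> t \<Longrightarrow> expectation (S t) = 0"
    and cov: "\<And>s t. 0 \<le> s \<Longrightarrow> 0 \<le> t \<Longrightarrow> expectation (\<lambda>\<omega>. S t \<omega> * S s \<omega>) =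
        s powr (2 * H) + t powr (2 * H) - 1/2 * (\<bar>s - t\<bar> powr (2 * H) + (s + t) powr (2 * H))"
    using S by (auto simp: sub_fractional_BM_def)
  have g: "gaussian_rv M (S t)" if "0 \<le> t" for t
    using G[unfolded gaussian_process_def, rule_format, of "{t}" "\<lambda>_. 1"] that by simp
  note int = integrable_centered_gaussian_power[OF g mean]
  have [measurable]: "S t \<in> borel_measurable M" if "0 \<le> t" for t
    using g[OF that] by (auto simp: gaussian_rv_def)
  have t: "0 \<le> t" using st by simp
  show "gaussian_rv M D"
    using G[unfolded gaussian_process_def, rule_format, of "{s, t}" "\<lambda>u. if u = t then 1 else -1"] st
    by (simp add: D_def)
  show "expectation D = 0"
    using int[OF st(1) st(1), of 1] int[OF t t, of 1] mean st t by (simp add: D_def)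
  \<comment> \<open>Needed to split the expectation of the square; the product is dominated by the
    sum of two squares, which are integrable as Gaussian moments.\<close>
  have intm: "integrable M (\<lambda>\<omega>. S t \<omega> * S s \<omega>)"
  proof (rule Bochner_Integration.integrable_bound)
    show "integrable M (\<lambda>\<omega>. (S t \<omega>)\<^sup>2 + (S s \<omega>)\<^sup>2)"
      using int st t by (intro Bochner_Integration.integrable_add) auto
    have "\<bar>a * b\<bar> \<le> \<bar>a\<^sup>2 + b\<^sup>2\<bar>" for a b :: real
      using sum_squares_bound[of a b] sum_squares_bound[of a "- b"]
      by (auto simp: abs_if)
    then show "AE \<omega> in M. norm (S t \<omega> * S s \<omega>) \<le> norm ((S t \<omega>)\<^sup>2 + (S s \<omega>)\<^sup>2)"
      by simp
  qed (use st t in measurable)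
  have "expectation (\<lambda>\<omega>. (D \<omega>)\<^sup>2) = expectation (\<lambda>\<omega>. (S t \<omega>)\<^sup>2 + (S s \<omega>)\<^sup>2 - 2 * (S t \<omega> * S s \<omega>))"
    by (simp add: D_def power2_eq_square algebra_simps)
  also have "\<dots> = expectation (\<lambda>\<omega>. (S t \<omega>)\<^sup>2) + expectation (\<lambda>\<omega>. (S s \<omega>)\<^sup>2) - 2 * expectation (\<lambda>\<omega>. S t \<omega> * S s \<omega>)"
    using int[OF t t, of 2] int[OF st(1) st(1), of 2] intm by simp
  also have "\<dots> = (t - s) powr (2 * H)
      - (2 powr (2 * H - 1) * (s powr (2 * H) + t powr (2 * H)) - (s + t) powr (2 * H))"
    using cov[OF t t] cov[OF st(1) st(1)] cov[OF st(1) t] st t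
    by (simp add: power2_eq_square powr_mult mult_2[symmetric] powr_diff algebra_simps)
  also have "\<dots> \<le> (t - s) powr (2 * H)"
    using powr_midpoint_convex[of "2 * H" s t] H st t by simp
  finally show "expectation (\<lambda>\<omega>. (D \<omega>)\<^sup>2) \<le> (t - s) powr (2 * H)" .
qed

text \<open>The variance at time one is positive because \<open>2 powr (2 * H) < 4\<close>. Together
  with \<open>S 0 = 0\<close> this keeps the path from being constant.\<close>

lemma sub_fractional_BM_AE_nonzero:
  assumes S: "sub_fractional_BM M H S" and H: "H < 1"
  shows "AE \<omega> in M. S 1 \<omega> \<noteq> 0"
proof (rule centered_gaussian_AE_nonzero)
  have G: "gaussian_process M {0..} S"
    using S by (auto simp: sub_fractional_BM_def)
  show "gaussian_rv M (S 1)"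
    using G[unfolded gaussian_process_def, rule_format, of "{1}" "\<lambda>_. 1"] by simp
  show "expectation (S 1) = 0"
    using S by (auto simp: sub_fractional_BM_def)
  have "expectation (\<lambda>\<omega>. S 1 \<omega> * S 1 \<omega>) = 2 - 1/2 * 2 powr (2 * H)"
    using S by (auto simp: sub_fractional_BM_def)
  moreover have "2 powr (2 * H) < 2 powr (2::real)"
    using H by (intro powr_less_mono) auto
  ultimately show "expectation (\<lambda>\<omega>. (S 1 \<omega>)\<^sup>2) \<noteq> 0"
    by (simp add: power2_eq_square)
qed

text \<open>Jensen's inequality gives a factor \<open>n ^ (p - 1)\<close>, the sum has
  \<open>n\<close> terms, and the moment of order \<open>2 * p\<close> of an increment is at most a
  constant times \<open>n powr (- 2 * H * p)\<close>.\<close>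

lemma sub_fractional_BM_quad_var_moment:
  assumes S: "sub_fractional_BM M H S" and H: "1/2 < H" and p: "even p" "0 < p"
  shows "integrable M (\<lambda>\<omega>. quad_var n (\<lambda>t. S t \<omega>) ^ p)"
    and "expectation (\<lambda>\<omega>. quad_var n (\<lambda>t. S t \<omega>) ^ p)
      \<le> fact (2 * p) / (2 ^ p * fact p) * real n powr (real p * (1 - 2 * H))"
proof -
  define D where "D i \<omega> = S (real i / real n) \<omega> - S (real (i - 1) / real n) \<omega>" for i \<omega>
  define C :: real where "C = fact (2 * p) / (2 ^ p * fact p)"
  have C: "0 \<le> C" by (simp add: C_def)
  have D: "gaussian_rv M (D i)" "expectation (D i) = 0"
      "expectation (\<lambda>\<omega>. (D i \<omega>)\<^sup>2) \<le> (1 / real n) powr (2 * H)" if "i \<in> {1..n}" for i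
  proof -
    have "real i / real n - real (i - 1) / real n = 1 / real n"
      using that by (simp add: of_nat_diff diff_divide_distrib)
    moreover have "real (i - 1) / real n < real i / real n"
      using that by (intro divide_strict_right_mono) auto
    ultimately show "gaussian_rv M (D i)" "expectation (D i) = 0"
      "expectation (\<lambda>\<omega>. (D i \<omega>)\<^sup>2) \<le> (1 / real n) powr (2 * H)"
      using sub_fractional_BM_increment[OF S H, of "real (i - 1) / real n" "real i / real n"]
      by (simp_all add: D_def[abs_def])
  qed
  have [measurable]: "D i \<in> borel_measurable M" if "i \<in> {1..n}" for i
    using D(1)[OF that] by (auto simp: gaussian_rv_def)
  have int: "integrable M (\<lambda>\<omega>. D i \<omega> ^ k)" if "i \<in> {1..n}" for i k
    using D that by (intro integrable_centered_gaussian_power)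
  have qv: "quad_var n (\<lambda>t. S t \<omega>) = (\<Sum>i=1..n. (D i \<omega>)\<^sup>2)" for \<omega>
    by (simp add: quad_var_def obs_def D_def)
  have le: "quad_var n (\<lambda>t. S t \<omega>) ^ p \<le> real n ^ (p - 1) * (\<Sum>i=1..n. D i \<omega> ^ (2 * p))" for \<omega>
    using sum_power_le_even[of "{1..n}" p "\<lambda>i. (D i \<omega>)\<^sup>2"] p
    by (simp add: qv power_mult del: One_nat_def)
  have ints: "integrable M (\<lambda>\<omega>. real n ^ (p - 1) * (\<Sum>i=1..n. D i \<omega> ^ (2 * p)))"
    using int by (intro integrable_mult_right Bochner_Integration.integrable_sum) auto
  have [measurable]: "(\<lambda>\<omega>. quad_var n (\<lambda>t. S t \<omega>) ^ p) \<in> borel_measurable M"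
    unfolding qv by (intro borel_measurable_power borel_measurable_sum) auto
  show intq: "integrable M (\<lambda>\<omega>. quad_var n (\<lambda>t. S t \<omega>) ^ p)"
    by (rule Bochner_Integration.integrable_bound[OF ints])
       (auto simp: quad_var_nonneg intro!: order.trans[OF le])
  have "expectation (\<lambda>\<omega>. quad_var n (\<lambda>t. S t \<omega>) ^ p)
      \<le> expectation (\<lambda>\<omega>. real n ^ (p - 1) * (\<Sum>i=1..n. D i \<omega> ^ (2 * p)))"
    by (intro integral_mono intq ints le)
  also have "\<dots> = real n ^ (p - 1) * (\<Sum>i=1..n. expectation (\<lambda>\<omega>. D i \<omega> ^ (2 * p)))"
    using int by (subst Bochner_Integration.integral_sum[symmetric]) auto
  also have "\<dots> \<le> real n ^ (p - 1) * (\<Sum>i=1..n. C * ((1 / real n) powr (2 * H)) ^ p)"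
  proof (intro mult_left_mono sum_mono)
    fix i assume i: "i \<in> {1..n}"
    have "expectation (\<lambda>\<omega>. D i \<omega> ^ (2 * p)) = C * expectation (\<lambda>\<omega>. (D i \<omega>)\<^sup>2) ^ p"
      using centered_gaussian_even_moment[OF D(1,2)[OF i]] by (simp add: C_def)
    also have "\<dots> \<le> C * ((1 / real n) powr (2 * H)) ^ p"
      by (intro mult_left_mono power_mono D i C) auto
    finally show "expectation (\<lambda>\<omega>. D i \<omega> ^ (2 * p)) \<le> C * ((1 / real n) powr (2 * H)) ^ p" .
  qed simp
  also have "\<dots> = C * real n powr (real p * (1 - 2 * H))"
  \<comment> \<open>For \<open>n = 0\<close> both sides vanish: the sum is empty and
    \<open>0 powr a = 0\<close>.\<close>
  proof (cases "n = 0")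
    case False
    have "real n ^ (p - 1) * real n = real n powr real p"
      using p False by (simp add: powr_realpow power_eq_if mult.commute)
    moreover have "((1 / real n) powr (2 * H)) ^ p = real n powr (- (2 * H * real p))"
      using False by (simp add: powr_realpow[symmetric] powr_powr powr_minus powr_divide inverse_eq_divide)
    ultimately have "real n ^ (p - 1) * (\<Sum>i=1..n. C * ((1 / real n) powr (2 * H)) ^ p)
        = C * (real n powr real p * real n powr (- (2 * H * real p)))"
      by (simp add: ac_simps)
    also have "\<dots> = C * real n powr (real p * (1 - 2 * H))"
      by (simp add: powr_add[symmetric] algebra_simps)
    finally show ?thesis .
  qed simp
  finally show "expectation (\<lambda>\<omega>. quad_var n (\<lambda>t. S t \<omega>) ^ p)
      \<le> fact (2 * p) / (2 ^ p * fact p) * real n powr (real p * (1 - 2 * H))"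
    by (simp add: C_def)
qed

lemma sub_fractional_BM_quad_var_tendsto_0:
  assumes S: "sub_fractional_BM M H S" and H: "1/2 < H"
  shows "AE \<omega> in M. (\<lambda>n. quad_var n (\<lambda>t. S t \<omega>)) \<longlonglongrightarrow> 0"
proof -
  obtain k :: nat where k: "1 / (2 * H - 1) < real k"
    using reals_Archimedean2 by blast
  \<comment> \<open>Even, as Jensen's inequality is used for even powers, and so large that
    \<open>p * (2 * H - 1) > 1\<close>, which makes the moment bounds summable.\<close>
  define p where "p = 2 * k"
  have "0 < k" using k H by (cases k) (auto simp: field_simps)
  then have p: "even p" "0 < p" by (auto simp: p_def)
  have "1 < real k * (2 * H - 1)"
    using k H by (simp add: field_simps)
  also have "\<dots> \<le> real p * (2 * H - 1)"
    using H by (intro mult_right_mono) (auto simp: p_def)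
  finally have exponent: "real p * (1 - 2 * H) < -1"
    by (simp add: algebra_simps)
  have "AE \<omega> in M. (\<lambda>n. quad_var n (\<lambda>t. S t \<omega>) ^ p) \<longlonglongrightarrow> 0"
  proof (rule AE_tendsto_0_if_summable_integral)
    show "summable (\<lambda>n. expectation (\<lambda>\<omega>. quad_var n (\<lambda>t. S t \<omega>) ^ p))"
    proof (rule summable_comparison_test')
      show "summable (\<lambda>n. fact (2 * p) / (2 ^ p * fact p) * real n powr (real p * (1 - 2 * H)))"
        using exponent by (intro summable_mult) (simp add: summable_real_powr_iff)
      show "norm (expectation (\<lambda>\<omega>. quad_var n (\<lambda>t. S t \<omega>) ^ p))
          \<le> fact (2 * p) / (2 ^ p * fact p) * real n powr (real p * (1 - 2 * H))" if "0 \<le> n" for n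
        using sub_fractional_BM_quad_var_moment(2)[OF S H p, of n] by (simp add: quad_var_nonneg)
    qed
  qed (auto intro: sub_fractional_BM_quad_var_moment[OF S H p] simp: quad_var_nonneg)
  then show ?thesis
  proof eventually_elim
    case (elim \<omega>)
    have "(\<lambda>n. root p (quad_var n (\<lambda>t. S t \<omega>) ^ p)) \<longlonglongrightarrow> root p 0"
      by (intro tendsto_real_root elim)
    with p show ?case by (simp add: real_root_power_cancel quad_var_nonneg)
  qed
qed

end

subsection \<open>Consistency\<close>

lemma eventually_snd_pos: "eventually (\<lambda>p. 0 < snd p) (F \<times>\<^sub>F at_right (0::real))"
  using filterlim_snd[of "at_right (0::real)" F] eventually_at_right_less[of "0::real"]
  by (rule filterlim_iff[THEN iffD1, rule_format])

lemma tendsto_snd_0: "(snd \<longlongrightarrow> 0) (F \<times>\<^sub>F at_right (0::real))"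
  using filterlim_snd[of "at_right (0::real)" F] by (simp add: filterlim_at)

text \<open>Purely deterministic: the randomness enters only through \<open>w\<close>. The condition
  on \<open>\<mu> + \<theta> * x0\<close> says that the noiseless solution does not start at an
  equilibrium, so that its variance over time is nonzero.\<close>

lemma vasicek_estimators_tendsto:
  assumes path: "\<And>\<sigma>. 0 < \<sigma> \<Longrightarrow> vasicek_path \<theta> \<mu> x0 \<sigma> w (X \<sigma>)"
    and w: "(\<lambda>n. quad_var n w) \<longlonglongrightarrow> 0" and ne: "\<mu> + \<theta> * x0 \<noteq> 0"
  shows "((\<lambda>(n, \<sigma>). theta_hat n (X \<sigma>)) \<longlongrightarrow> \<theta>) (sequentially \<times>\<^sub>F at_right 0)"
    and "((\<lambda>(n, \<sigma>). mu_hat n (X \<sigma>)) \<longlongrightarrow> \<mu>) (sequentially \<times>\<^sub>F at_right 0)"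
proof -
  txt \<open>The noise cancels in \<open>x\<close>; the initial value and \<open>\<mu>\<close> cancel in \<open>y\<close>.\<close>
  define x where "x = (\<lambda>t. 2 * X 1 t + (-1) * X 2 t)"
  define y where "y = (\<lambda>t. (-1) * X 1 t + 1 * X 2 t)"
  have x: "vasicek_path \<theta> \<mu> x0 0 w x"
    unfolding x_def using vasicek_path_lincomb[OF path[of 1] path[of 2], of 2 "-1"] by simp
  have y: "vasicek_path \<theta> 0 0 1 w y"
    unfolding y_def using vasicek_path_lincomb[OF path[of 1] path[of 2], of "-1" 1] by simp
  have cont: "continuous_on {0..1} x" "continuous_on {0..1} y"
    using x y by (auto simp: vasicek_path_def)
  \<comment> \<open>Uniqueness carries the decomposition from the noise levels \<open>1\<close> and
    \<open>2\<close> to every positive \<open>\<sigma>\<close>.\<close>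
  have X: "X \<sigma> t = x t + \<sigma> * y t" if "0 < \<sigma>" "t \<in> {0..1}" for \<sigma> t
  proof (rule vasicek_path_unique[OF path[OF that(1)] _ that(2)])
    show "vasicek_path \<theta> \<mu> x0 \<sigma> w (\<lambda>t. x t + \<sigma> * y t)"
      using vasicek_path_lincomb[OF x y, of 1 \<sigma>] by simp
  qed
  have qx: "(\<lambda>n. quad_var n x) \<longlonglongrightarrow> 0" and qy: "(\<lambda>n. quad_var n y) \<longlonglongrightarrow> 0"
    using quad_var_vasicek_path[OF x] quad_var_vasicek_path[OF y] w by auto
  define m where "m = integral {0..1} x"
  define q where "q = integral {0..1} (\<lambda>t. (x t)\<^sup>2)"
  note mom = vasicek_path_moments[OF x, folded m_def q_def]
  have V: "q - m\<^sup>2 \<noteq> 0"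
  proof -
    have x0: "x 0 = x0" and xt: "x t = x0 + integral {0..t} (\<lambda>s. \<mu> + \<theta> * x s)" if "t \<in> {0..1}" for t
      using x that by (auto simp: vasicek_path_def)
    have "\<exists>t\<in>{0..1}. x t \<noteq> x 0"
    proof (rule ccontr)
      assume "\<not> ?thesis"
      then have c: "x t = x0" if "t \<in> {0..1}" for t
        using that x0[of t] by metis
      then have "integral {0..1} (\<lambda>s. \<mu> + \<theta> * x s) = integral {0..1} (\<lambda>s::real. \<mu> + \<theta> * x0)"
        by (intro Henstock_Kurzweil_Integration.integral_cong) simp
      with xt[of 1] c[of 1] ne show False by simp
    qed
    then show ?thesis
      unfolding q_def m_def using variance_pos[OF cont(1)] by blast
  qed
  note lims = theta_hat_tendsto[OF cont qx qy filterlim_fst tendsto_snd_0] mu_hat_tendsto[OF cont qx qy filterlim_fst tendsto_snd_0]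
  have theta: "theta_hat n (X \<sigma>) = theta_hat n (\<lambda>t. x t + \<sigma> * y t)"
    and mu: "mu_hat n (X \<sigma>) = mu_hat n (\<lambda>t. x t + \<sigma> * y t)" if "0 < \<sigma>" for n \<sigma>
    by (rule theta_hat_cong mu_hat_cong, erule X[OF that])+
  show "((\<lambda>(n, \<sigma>). theta_hat n (X \<sigma>)) \<longlongrightarrow> \<theta>) (sequentially \<times>\<^sub>F at_right 0)"
  proof (rule Lim_transform_eventually)
    \<comment> \<open>By the two moment relations the numerator is
      \<open>\<theta> * (q - m^2)\<close>; for the other estimator it is
      \<open>\<mu> * (q - m^2)\<close>.\<close>
    have "(((x 1)\<^sup>2 - (x 0)\<^sup>2) / 2 - m * (x 1 - x 0)) / (q - m\<^sup>2) = \<theta>"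
      using V unfolding mom by (simp add: field_simps power2_eq_square)
    then show "((\<lambda>p. theta_hat (fst p) (\<lambda>t. x t + snd p * y t)) \<longlongrightarrow> \<theta>) (sequentially \<times>\<^sub>F at_right 0)"
      using lims(1) V by (simp add: m_def q_def)
    show "eventually (\<lambda>p. theta_hat (fst p) (\<lambda>t. x t + snd p * y t) = (case p of (n, \<sigma>) \<Rightarrow> theta_hat n (X \<sigma>)))
        (sequentially \<times>\<^sub>F at_right 0)"
      using eventually_snd_pos by eventually_elim (auto simp: theta split: prod.splits)
  qed
  show "((\<lambda>(n, \<sigma>). mu_hat n (X \<sigma>)) \<longlongrightarrow> \<mu>) (sequentially \<times>\<^sub>F at_right 0)"
  proof (rule Lim_transform_eventually)
    have "((x 1 - x 0) * q - m * (((x 1)\<^sup>2 - (x 0)\<^sup>2) / 2)) / (q - m\<^sup>2) = \<mu>"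
      using V unfolding mom by (simp add: field_simps power2_eq_square)
    then show "((\<lambda>p. mu_hat (fst p) (\<lambda>t. x t + snd p * y t)) \<longlongrightarrow> \<mu>) (sequentially \<times>\<^sub>F at_right 0)"
      using lims(2) V by (simp add: m_def q_def)
    show "eventually (\<lambda>p. mu_hat (fst p) (\<lambda>t. x t + snd p * y t) = (case p of (n, \<sigma>) \<Rightarrow> mu_hat n (X \<sigma>)))
        (sequentially \<times>\<^sub>F at_right 0)"
      using eventually_snd_pos by eventually_elim (auto simp: mu split: prod.splits)
  qed
qed

lemma vasicek_mu_hat_tendsto_0:
  assumes path: "\<And>\<sigma>. 0 < \<sigma> \<Longrightarrow> vasicek_path \<theta> 0 0 \<sigma> w (X \<sigma>)"
    and w: "(\<lambda>n. quad_var n w) \<longlonglongrightarrow> 0" "w 0 = 0" "w 1 \<noteq> 0"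
  shows "((\<lambda>(n, \<sigma>). mu_hat n (X \<sigma>)) \<longlongrightarrow> 0) (sequentially \<times>\<^sub>F at_right 0)"
proof -
  have X: "X \<sigma> t = \<sigma> * X 1 t" if "0 < \<sigma>" "t \<in> {0..1}" for \<sigma> t
  proof (rule vasicek_path_unique[OF path[OF that(1)] _ that(2)])
    show "vasicek_path \<theta> 0 0 \<sigma> w (\<lambda>t. \<sigma> * X 1 t)"
      using vasicek_path_lincomb[OF path[of 1] path[of 1], of \<sigma> 0] by simp
  qed
  have cont: "continuous_on {0..1} (X 1)"
    and eq: "\<And>t. t \<in> {0..1} \<Longrightarrow> X 1 t = integral {0..t} (\<lambda>s. \<theta> * X 1 s) + w t"
    using path[of 1] by (auto simp: vasicek_path_def)
  have "\<exists>t\<in>{0..1}. X 1 t \<noteq> X 1 0"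
  proof (rule ccontr)
    assume "\<not> ?thesis"
    \<comment> \<open>A constant path is zero because it starts at \<open>w 0 = 0\<close>; the
      equation at time one then contradicts \<open>w 1 \<noteq> 0\<close>.\<close>
    then have c: "X 1 t = 0" if "t \<in> {0..1}" for t
      using that eq[of 0] w(2) by auto
    then have "integral {0..1} (\<lambda>s. \<theta> * X 1 s) = integral {0..1} (\<lambda>s::real. 0)"
      by (intro Henstock_Kurzweil_Integration.integral_cong) simp
    with eq[of 1] c[of 1] w(3) show False by auto
  qed
  then have "integral {0..1} (\<lambda>t. (X 1 t)\<^sup>2) - (integral {0..1} (X 1))\<^sup>2 \<noteq> 0"
    using variance_pos[OF cont] by blast
  \<comment> \<open>Applied with zero perturbation along \<open>n\<close> alone. Only the existence
    of a limit matters, since it is multiplied by \<open>\<sigma>\<close>, which tends to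
    \<open>0\<close>.\<close>
  from mu_hat_tendsto[OF cont cont _ _ filterlim_ident tendsto_const this]
  obtain l where "(\<lambda>n. mu_hat n (X 1)) \<longlonglongrightarrow> l"
    using quad_var_vasicek_path[OF path[of 1]] w(1) by auto
  from tendsto_mult[OF tendsto_snd_0 filterlim_compose[OF this filterlim_fst]]
  have "((\<lambda>p. snd p * mu_hat (fst p) (X 1)) \<longlongrightarrow> 0) (sequentially \<times>\<^sub>F at_right 0)"
    by simp
  moreover have "eventually (\<lambda>p. snd p * mu_hat (fst p) (X 1) = (case p of (n, \<sigma>) \<Rightarrow> mu_hat n (X \<sigma>)))
      (sequentially \<times>\<^sub>F at_right 0)"
    using eventually_snd_pos
  proof eventually_elim
    case (elim p)
    have "mu_hat (fst p) (X (snd p)) = mu_hat (fst p) (\<lambda>t. snd p * X 1 t)"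
      by (rule mu_hat_cong) (rule X[OF elim])
    then show ?case by (cases p) (simp add: mu_hat_cmult)
  qed
  ultimately show ?thesis by (rule Lim_transform_eventually)
qed

text \<open>If \<open>\<mu>0 + \<theta>0 * x0 = 0\<close>, then \<open>X = x0 + \<sigma> * y\<close>
  on the unit interval. Being invariant under such affine maps, \<open>theta_hat\<close> does not
  depend on \<open>\<sigma>\<close>, so small noise cannot help it. As \<open>mu_hat\<close> is the
  increment of \<open>X\<close> minus \<open>theta_hat\<close> times its average whenever the
  empirical variance is nonzero, the error of \<open>theta_hat\<close> enters with the factor
  \<open>x0\<close> in the limit, which explains the alternative \<open>x0 = 0\<close>.\<close>

theorem theorem3p1:
  fixes M :: "'a measure"
    and H \<theta>0 \<mu>0 x0 :: real
    and S :: "real \<Rightarrow> 'a \<Rightarrow> real"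
    and X :: "real \<Rightarrow> real \<Rightarrow> 'a \<Rightarrow> real"
  assumes "prob_space M"
    and "1/2 < H" "H < 1"
    and "sub_fractional_BM M H S"
    and "AE \<omega> in M. \<forall>\<sigma>>0. vasicek_path \<theta>0 \<mu>0 x0 \<sigma> (\<lambda>t. S t \<omega>) (\<lambda>t. X \<sigma> t \<omega>)"
  shows "(\<mu>0 + \<theta>0 * x0 \<noteq> 0 \<longrightarrow>
      (AE \<omega> in M. ((\<lambda>(n, \<sigma>). theta_hat n (\<lambda>t. X \<sigma> t \<omega>)) \<longlongrightarrow> \<theta>0)
         (sequentially \<times>\<^sub>F at_right 0)))
    \<and> (\<mu>0 + \<theta>0 * x0 \<noteq> 0 \<or> x0 = 0 \<longrightarrow>
      (AE \<omega> in M. ((\<lambda>(n, \<sigma>). mu_hat n (\<lambda>t. X \<sigma> t \<omega>)) \<longlongrightarrow> \<mu>0)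
         (sequentially \<times>\<^sub>F at_right 0)))"
proof -
  interpret prob_space M by fact
  note S = assms(4)
  note ae = assms(5) sub_fractional_BM_quad_var_tendsto_0[OF S assms(2)]
    sub_fractional_BM_AE_nonzero[OF S assms(3)]
  have S0: "AE \<omega> in M. S 0 \<omega> = 0"
    using S by (auto simp: sub_fractional_BM_def)
  have "AE \<omega> in M. ((\<lambda>(n, \<sigma>). theta_hat n (\<lambda>t. X \<sigma> t \<omega>)) \<longlongrightarrow> \<theta>0) (sequentially \<times>\<^sub>F at_right 0)"
    if "\<mu>0 + \<theta>0 * x0 \<noteq> 0"
    using ae(1,2)
    by eventually_elim (rule vasicek_estimators_tendsto[OF _ _ that], auto)
  moreover have "AE \<omega> in M. ((\<lambda>(n, \<sigma>). mu_hat n (\<lambda>t. X \<sigma> t \<omega>)) \<longlongrightarrow> \<mu>0) (sequentially \<times>\<^sub>F at_right 0)"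
    if "\<mu>0 + \<theta>0 * x0 \<noteq> 0 \<or> x0 = 0"
  proof (cases "\<mu>0 + \<theta>0 * x0 = 0")
    case False
    show ?thesis
      using ae(1,2)
      by eventually_elim (rule vasicek_estimators_tendsto[OF _ _ False], auto)
  next
    case True
    with that have "x0 = 0" "\<mu>0 = 0" by auto
    note path = ae(1)[unfolded this]
    show ?thesis
      unfolding \<open>\<mu>0 = 0\<close> using path ae(2,3) S0
      by eventually_elim (rule vasicek_mu_hat_tendsto_0, auto)
  qed
  ultimately show ?thesis by blast
qed

end
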